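(* Let $k\in\mathbb{N}$. Define the following subsets of the dihedral group $D_{3(2k+1)^2+1}$ of order $3(2k+1)^2+1$: $$C_0=\bigcup_{i=0}^{2k}\{r^{-k+i}\},\qquad C_1=\bigcup_{i=0}^{2k}\{r^{k+1+(3k+2)i}s^i\},\qquad C_2=\bigcup_{i=0}^{2k}\{r^{2k+1+(3k+1)i}s^{i+1}\},$$ where the orders of $r$ and $s$ are $\frac{3(2k+1)^2+1}{2}$ and $2$ respectively. Then $(C_0,C_1,C_2)$ forms a $(3(2k+1)^2+1,3,2k+1,1)$-CEDF in the dihedral group $D_{3(2k+1)^2+1}$.
   Context: $D_{2n}=\langle r,s: r^n=s^2=e,\ srs=r^{-1}\rangle$ denotes the dihedral group of order $2n$; here $2n=3(2k+1)^2+1$. For a group $K$ with multiplication $*$ and subsets $X,Y\subseteq K$, $D(X,Y;K)$ is the multiset $\{x*y^{-1}:x\in X,\ y\in Y\}$. CEDF (circular external difference family): let $K$ be a group of order $v$ with identity $e$ and let $m>1$. An ordered collection $(C_0,\ldots,C_{m-1})$ of disjoint subsets of $K$, each of size $l$, is a $(v,m,l,\lambda)$-CEDF in $K$ if the multiset union $\bigcup_{i=0}^{m-1}D(C_{i+1 \bmod m},C_i;K)$ equals the multiset consisting of $\lambda$ copies of $K\setminus\{e\}$. *)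

theory Defs
  imports
    "HOL-Algebra.Generated_Groups"
    "HOL-Algebra.Multiplicative_Group"
    "HOL-Library.Multiset"
begin

(* The presentation <r, s | r^n = s^2 = e, s r s = r^-1> defines a group of order 2 n. A group
   that is generated by elements satisfying these relations is a quotient of that group, hence
   isomorphic to it (with r, s corresponding to the generators) iff its order is 2 n. *)

locale dihedral_group = group G for G (structure) +
  fixes n :: nat and r s :: 'a
  assumes n_pos: "n > 0"
    and r_closed: "r \<in> carrier G"
    and s_closed: "s \<in> carrier G"
    and generators: "generate G {r, s} = carrier G"
    and r_pow_n: "r [^] n = \<one>"
    and s_square: "s [^] (2::nat) = \<one>"
    and s_r_s: "s \<otimes> r \<otimes> s = inv r"
    and order_eq: "order G = 2 * n"

definition diff_mset :: "('a, 'b) monoid_scheme \<Rightarrow> 'a set \<Rightarrow> 'a set \<Rightarrow> 'a multiset" where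
  "diff_mset K X Y = image_mset (\<lambda>(x, y). x \<otimes>\<^bsub>K\<^esub> inv\<^bsub>K\<^esub> y) (mset_set (X \<times> Y))"

(* Finiteness is explicit because order is 0 for infinite carriers and mset_set of an infinite
   set is empty. *)

definition is_CEDF ::
    "('a, 'b) monoid_scheme \<Rightarrow> nat \<Rightarrow> nat \<Rightarrow> nat \<Rightarrow> nat \<Rightarrow> 'a set list \<Rightarrow> bool" where
  "is_CEDF K v m l lam C \<longleftrightarrow>
     group K \<and> finite (carrier K) \<and> order K = v \<and> m > 1 \<and> length C = m \<and>
     (\<forall>i<m. C ! i \<subseteq> carrier K \<and> card (C ! i) = l) \<and>
     (\<forall>i<m. \<forall>j<m. i \<noteq> j \<longrightarrow> C ! i \<inter> C ! j = {}) \<and>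
     (\<Sum>i<m. diff_mset K (C ! ((i + 1) mod m)) (C ! i)) =
       repeat_mset lam (mset_set (carrier K - {\<one>\<^bsub>K\<^esub>}))"

lemma (in dihedral_group) finite_carrier: "finite (carrier G)"
  using order_eq n_pos by (metis card.infinite mult_is_0 neq0_conv order_def zero_neq_numeral)

(* The locale is inhabited for every n > 0. *)

definition dihedral_model :: "nat \<Rightarrow> (int \<times> bool) monoid" where
  "dihedral_model n = \<lparr>carrier = {0..<int n} \<times> UNIV,
     monoid.mult = (\<lambda>(a, x) (b, y). ((a + (if x then - b else b)) mod int n, x \<noteq> y)),
     one = (0, False)\<rparr>"

lemma dihedral_model_group:
  assumes "n > 0"
  shows "group (dihedral_model n)"
proof (rule groupI)
  fix x assume "x \<in> carrier (dihedral_model n)"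
  then obtain a b where ab: "x = (a, b)" "0 \<le> a" "a < int n"
    by (auto simp: dihedral_model_def)
  show "\<exists>y\<in>carrier (dihedral_model n). y \<otimes>\<^bsub>dihedral_model n\<^esub> x = \<one>\<^bsub>dihedral_model n\<^esub>"
    using ab assms
    by (intro bexI[of _ "if b then x else ((- a) mod int n, False)"])
       (auto simp: dihedral_model_def mod_simps)
qed (use assms in \<open>auto simp: dihedral_model_def mod_simps algebra_simps\<close>)

lemma dihedral_model_pow:
  assumes "n > 0"
  shows "(1 mod int n, False) [^]\<^bsub>dihedral_model n\<^esub> (i::nat) = (int i mod int n, False)"
  by (induction i) (auto simp: dihedral_model_def nat_pow_def mod_simps algebra_simps)

lemma dihedral_model_dihedral:
  assumes "n > 0"
  shows "dihedral_group (dihedral_model n) n (1 mod int n, False) (0, True)"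
proof -
  let ?G = "dihedral_model n" and ?r = "(1 mod int n, False)" and ?s = "(0 :: int, True)"
  interpret group ?G by (rule dihedral_model_group[OF assms])
  have cl: "?r \<in> carrier ?G" "?s \<in> carrier ?G"
    using assms by (auto simp: dihedral_model_def)
  have pow: "?r [^]\<^bsub>?G\<^esub> i \<in> generate ?G {?r, ?s}" for i :: nat
    by (induction i) (auto intro: generate.intros)
  have "x \<in> generate ?G {?r, ?s}" if x: "x \<in> carrier ?G" for x
  proof -
    obtain a b where ab: "x = (a, b)" "0 \<le> a" "a < int n"
      using x by (auto simp: dihedral_model_def)
    have p: "?r [^]\<^bsub>?G\<^esub> nat a = (a, False)"
      using ab by (simp add: dihedral_model_pow[OF assms])
    show ?thesis
    proof (cases b)
      case True
      have "x = ?r [^]\<^bsub>?G\<^esub> nat a \<otimes>\<^bsub>?G\<^esub> ?s"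
        unfolding p using True ab by (simp add: dihedral_model_def)
      then show ?thesis using pow by (auto intro: generate.intros)
    next
      case False
      then show ?thesis using pow[of "nat a"] p ab by simp
    qed
  qed
  then have gen: "generate ?G {?r, ?s} = carrier ?G"
    using generate_incl[of "{?r, ?s}"] cl by blast
  have inv: "?s \<otimes>\<^bsub>?G\<^esub> ?r \<otimes>\<^bsub>?G\<^esub> ?s = inv\<^bsub>?G\<^esub> ?r"
    by (rule inv_equality[symmetric])
       (use cl assms in \<open>auto simp: dihedral_model_def mod_simps\<close>)
  show ?thesis
    by unfold_locales
       (use assms cl gen inv in \<open>auto simp: dihedral_model_pow order_def numeral_2_eq_2,
         auto simp: dihedral_model_def card_cartesian_product\<close>)
qed

end

theory Submission
  imports Defs "HOL-Number_Theory.Cong"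
begin

text \<open>
  The three difference multisets have together at most $3(2k+1)^2$ entries, which is one less than
  the order of the group. So it is enough that every non-identity element is \<^emph>\<open>some\<close> difference: by counting
  it is then the only one, the identity is not a difference, and both the disjointness and the sizes
  of the three sets come for free (lemma \<open>is_CEDF_if_differences_cover\<close>).

  For the covering, write elements as $r^x s^e$. Since $s$ inverts $r$, the quotient of $r^x s^e$ by
  $r^y s^f$ is $r^{x-y}$ if $e+f$ is even and $r^{x+y} s$ if $e+f$ is odd. Put $U = \{-k,\dots,k\}$,
  $b_i = k+1+(3k+2)i$ and $c_i = 2k+1+(3k+1)i$ for $0 \le i \le 2k$. The differences $C_1C_0^{-1}$,
  $C_0C_2^{-1}$, $C_2C_1^{-1}$ contribute to the rotations the exponents
  \[ b_i - U \ (i \mbox{ even}), \qquad U - c_i \ (i \mbox{ odd}), \qquad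
     c_j - b_i \ (i+j \mbox{ odd}) \]
  and to the reflections the exponents
  \[ b_i + U \ (i \mbox{ odd}), \qquad U + c_i \ (i \mbox{ even}), \qquad
     c_j + b_i \ (i+j \mbox{ even}). \]
  The first two kinds are blocks of $2k+1$ consecutive integers, spaced by $6k+4$ and by $6k+2$
  respectively. As the two spacings differ by 2, the gaps between neighbouring blocks of different
  kinds grow or shrink by 2 from one period to the next, and the terms of the third kind with a
  fixed value of $i-j$ (for rotations) or $i+j$ (for reflections) are runs of consecutive
  integers that fill these gaps. The lemmas \<open>rotation_exponents_cover\<close> and
  \<open>reflection_exponents_cover\<close> carry this out modulo $n = 6k^2+6k+2$.
\<close>

section \<open>Covering implies exactness\<close>

lemma three_products_at_maximum:
  fixes a b c L :: nat
  assumes "a \<le> L" "b \<le> L" "c \<le> L" and "3 * L^2 \<le> b * a + c * b + a * c"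
  shows "a = L"
proof (rule ccontr)
  assume "a \<noteq> L"
  then have "a < L" using assms(1) by simp
  then have "L * a < L * L" by simp
  moreover have "b * a \<le> L * a" "c * b \<le> L * L" "a * c \<le> a * L"
    using assms by (simp_all add: mult_le_mono)
  ultimately have "b * a + c * b + a * c < 3 * (L * L)"
    using mult.commute[of a L] by linarith
  then show False
    using assms(4) by (simp add: power2_eq_square)
qed

lemma mset_eq_if_covers:
  assumes "finite S" and "S \<subseteq> set_mset M" and "size M \<le> card S"
  shows "M = mset_set S"
proof -
  have sub: "mset_set S \<subseteq># M"
    using assms(1,2) by (auto simp: subseteq_mset_def count_mset_set' Suc_le_eq subset_iff)
  then have "size (M - mset_set S) = 0"
    using assms(3) by (simp add: size_Diff_submset)
  then show ?thesis
    using sub by (metis size_eq_0_iff_empty subset_mset.diff_add add_0)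
qed

lemma size_diff_mset: "size (diff_mset K X Y) = card X * card Y"
  by (simp add: diff_mset_def card_cartesian_product)

lemma in_diff_mset:
  assumes "finite X" "finite Y"
  shows "g \<in># diff_mset K X Y \<longleftrightarrow> (\<exists>x\<in>X. \<exists>y\<in>Y. g = x \<otimes>\<^bsub>K\<^esub> inv\<^bsub>K\<^esub> y)"
  using assms by (auto simp: diff_mset_def)

text \<open>
  If the sizes $a, b, c$ of the sets are at most $L$, then the number of differences $ba + cb + ac$ is
  at most $3L^2$, which is the number of non-identity elements. A covering therefore uses each
  non-identity element once and never the identity; a common element of two sets would give the
  identity as a difference, because any two of three cyclically ordered sets are neighbours.
  Equality in the count also forces all three sizes to be $L$.
\<close>

lemma is_CEDF_if_differences_cover:
  fixes K :: "('a, 'b) monoid_scheme"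
  assumes "group K" and fin: "finite (carrier K)" and ord: "order K = 3 * L^2 + 1"
    and sub: "A \<subseteq> carrier K" "B \<subseteq> carrier K" "C \<subseteq> carrier K"
    and card: "card A \<le> L" "card B \<le> L" "card C \<le> L"
    and cover: "\<And>g. g \<in> carrier K \<Longrightarrow> g \<noteq> \<one>\<^bsub>K\<^esub> \<Longrightarrow>
      g \<in># diff_mset K B A + diff_mset K C B + diff_mset K A C"
  shows "is_CEDF K (3 * L^2 + 1) 3 L 1 [A, B, C]"
proof -
  interpret group K by fact
  let ?S = "carrier K - {\<one>\<^bsub>K\<^esub>}"
  let ?M = "diff_mset K B A + diff_mset K C B + diff_mset K A C"
  have finite: "finite A" "finite B" "finite C"
    using sub fin by (auto intro: finite_subset)
  have card_S: "card ?S = 3 * L^2"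
    using fin ord by (simp add: order_def)
  have size_M: "size ?M = card B * card A + card C * card B + card A * card C"
    by (simp add: size_diff_mset)
  have S_sub: "?S \<subseteq> set_mset ?M"
    using cover by blast
  have "card B * card A \<le> L * L" "card C * card B \<le> L * L" "card A * card C \<le> L * L"
    using card by (simp_all add: mult_le_mono)
  then have "size ?M \<le> card ?S"
    unfolding size_M card_S by (simp add: power2_eq_square)
  then have M: "?M = mset_set ?S"
    using S_sub fin by (intro mset_eq_if_covers) auto
  have total: "3 * L^2 = card B * card A + card C * card B + card A * card C"
    unfolding size_M[symmetric] M by (simp add: card_S)
  have cards: "card A = L" "card B = L" "card C = L"
    using three_products_at_maximum[of "card A" L "card B" "card C"]
      three_products_at_maximum[of "card B" L "card C" "card A"]
      three_products_at_maximum[of "card C" L "card A" "card B"] card total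
    by (simp_all add: algebra_simps)
  have no_one: "\<one>\<^bsub>K\<^esub> \<notin># ?M"
    using fin by (simp add: M)
  have disj: "X \<inter> Y = {}"
    if "diff_mset K X Y \<subseteq># ?M" "X \<subseteq> carrier K" "finite X" "finite Y" for X Y
  proof (rule ccontr)
    assume "X \<inter> Y \<noteq> {}"
    then obtain x where "x \<in> X" "x \<in> Y" by blast
    then have "\<one>\<^bsub>K\<^esub> \<in># diff_mset K X Y"
      using that by (auto simp: in_diff_mset intro!: bexI[of _ x])
    then show False
      using no_one that(1) by (meson mset_subset_eqD)
  qed
  have "B \<inter> A = {}" "C \<inter> B = {}" "A \<inter> C = {}"
    using disj[of B A] disj[of C B] disj[of A C] sub finite
    by (simp_all add: add.assoc[symmetric] subset_mset.le_iff_add)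
  moreover have below_3: "(\<forall>i<3. P i) \<longleftrightarrow> P 0 \<and> P 1 \<and> P 2" for P :: "nat \<Rightarrow> bool"
    by (auto simp: numeral_3_eq_3 less_Suc_eq numeral_2_eq_2)
  have "(\<Sum>i<3. diff_mset K ([A, B, C] ! ((i + 1) mod 3)) ([A, B, C] ! i)) = ?M"
  proof -
    have "{..<3::nat} = {0, 1, 2}" by auto
    then show ?thesis by (simp add: add.assoc)
  qed
  moreover have "repeat_mset 1 (mset_set ?S) = mset_set ?S"
    by simp
  ultimately show ?thesis
    using cards sub fin ord group_axioms
    unfolding is_CEDF_def below_3 M by (simp add: Int_commute)
qed

section \<open>Normal forms in the dihedral group\<close>

context dihedral_group
begin

text \<open>
  The exponent of \<open>r\<close> is an integer because quotients subtract exponents; the exponent of \<open>s\<close> is kept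
  as an unreduced natural number, of which only the parity matters, because it runs through all
  indices up to $2k+1$ in the family.
\<close>

definition word :: "int \<Rightarrow> nat \<Rightarrow> 'a" where
  "word x e = r [^] x \<otimes> s [^] e"

lemma word_closed [simp]: "word x e \<in> carrier G"
  by (simp add: word_def r_closed s_closed)

lemma s_pow_mod_2: "s [^] (e::nat) = s [^] (e mod 2)"
proof -
  have "s [^] e = s [^] (2 * (e div 2) + e mod 2)" by simp
  also have "\<dots> = (s [^] (2::nat)) [^] (e div 2) \<otimes> s [^] (e mod 2)"
    by (simp only: nat_pow_mult[OF s_closed, symmetric] nat_pow_pow[OF s_closed, symmetric])
  finally show ?thesis
    by (simp add: s_square s_closed)
qed

lemma word_cong:
  assumes "[x = y] (mod int n)" and "even e \<longleftrightarrow> even f"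
  shows "word x e = word y f"
proof -
  obtain q where "x = y + int n * q"
    using assms(1) by (metis cong_iff_lin cong_sym)
  moreover have "r [^] (int n * q) = \<one>"
    by (simp add: int_pow_pow[OF r_closed, symmetric] int_pow_int r_pow_n)
  ultimately have "r [^] x = r [^] y"
    by (simp add: int_pow_mult[OF r_closed] r_closed)
  moreover have "e mod 2 = f mod 2"
    using assms(2) by presburger
  then have "s [^] e = s [^] f"
    by (metis s_pow_mod_2)
  ultimately show ?thesis
    by (simp add: word_def)
qed

lemma inv_s: "inv s = s"
  using s_square s_closed by (intro inv_equality) (auto simp: numeral_2_eq_2)

lemma s_conj_r_pow: "s \<otimes> r [^] (x::int) \<otimes> s = r [^] (- x)"
proof -
  have "s \<otimes> r [^] (x::int) \<otimes> inv s = (s \<otimes> r \<otimes> inv s) [^] x"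
  proof -
    have "(\<lambda>g. s \<otimes> g \<otimes> inv s) \<in> hom G G"
      using s_closed by (auto simp: hom_def m_assoc inv_solve_left)
    then show ?thesis
      using r_closed by (metis (no_types, lifting) hom_int_pow is_group)
  qed
  then show ?thesis
    using r_closed by (simp add: inv_s s_r_s int_pow_neg int_pow_inv)
qed

lemma s_r_pow: "s \<otimes> r [^] (x::int) = r [^] (- x) \<otimes> s"
proof -
  have "r [^] (- x) \<otimes> s = s \<otimes> r [^] x \<otimes> (s \<otimes> s)"
    using s_conj_r_pow[of x, symmetric] r_closed s_closed by (simp add: m_assoc)
  then show ?thesis
    using s_square r_closed s_closed by (simp add: numeral_2_eq_2)
qed

lemma s_pow_r_pow:
  "s [^] (e::nat) \<otimes> r [^] (x::int) = r [^] (if even e then x else - x) \<otimes> s [^] e"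
proof -
  have "s [^] e = (if even e then \<one> else s)"
    using s_pow_mod_2[of e] s_closed by (auto simp: odd_iff_mod_2_eq_one)
  then show ?thesis
    using s_r_pow r_closed by auto
qed

lemma word_mult: "word x e \<otimes> word y f = word (if even e then x + y else x - y) (e + f)"
proof -
  have "word x e \<otimes> word y f = r [^] x \<otimes> (s [^] e \<otimes> r [^] y) \<otimes> s [^] f"
    using r_closed s_closed by (simp add: word_def m_assoc)
  also have "\<dots> = (r [^] x \<otimes> r [^] (if even e then y else - y)) \<otimes> (s [^] e \<otimes> s [^] f)"
    using r_closed s_closed by (simp add: s_pow_r_pow m_assoc)
  also have "\<dots> = word (if even e then x + y else x - y) (e + f)"
    using r_closed s_closed by (simp add: word_def nat_pow_mult int_pow_mult[symmetric])
  finally show ?thesis .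
qed

lemma word_0_0: "word 0 0 = \<one>"
  by (simp add: word_def)

lemma inv_word: "inv (word x e) = word (if even e then - x else x) e"
proof (rule inv_equality)
  have "word (if even e then - x else x) e \<otimes> word x e = word 0 (e + e)"
    by (simp add: word_mult)
  also have "\<dots> = word 0 0"
    by (rule word_cong) auto
  finally show "word (if even e then - x else x) e \<otimes> word x e = \<one>"
    by (simp add: word_0_0)
qed auto

text \<open>
  When \<open>e + f\<close> is odd, the remaining \<open>s\<close> passes the inverse power of \<open>r\<close> and turns it back,
  so that the exponents add up.
\<close>

lemma word_diff:
  "word x e \<otimes> inv (word y f) = word (if even (e + f) then x - y else x + y) (e + f)"
  by (auto simp: inv_word word_mult)

text \<open>
  The normal forms contain both generators and are closed under products and inverses by the
  formulas above, so they exhaust the generated group.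
\<close>

lemma exists_word:
  assumes "g \<in> carrier G"
  shows "\<exists>x e. g = word x e"
proof -
  have "g \<in> generate G {r, s}"
    using assms generators by simp
  then show ?thesis
  proof induction
    case one
    then show ?case using word_0_0 by metis
  next
    case (incl h)
    have "r = word 1 0" "s = word 0 1"
      using r_closed s_closed by (simp_all add: word_def)
    with incl show ?case by blast
  next
    case (inv h)
    have "r = word 1 0" "s = word 0 1"
      using r_closed s_closed by (simp_all add: word_def)
    with inv show ?case by (metis empty_iff insert_iff inv_word)
  next
    case (eng h1 h2)
    then show ?case by (metis word_mult)
  qed
qed

lemma word_in_diff_mset:
  assumes "word x e \<in> X" "word y f \<in> Y" and "finite X" "finite Y"
    and "[z = (if even (e + f) then x - y else x + y)] (mod int n)"
    and "even h \<longleftrightarrow> even (e + f)"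
  shows "word z h \<in># diff_mset G X Y"
proof -
  have "word z h = word x e \<otimes> inv (word y f)"
    unfolding word_diff using assms(5,6) by (rule word_cong)
  then show ?thesis
    using assms(1-4) by (auto simp: in_diff_mset)
qed

end

section \<open>Tiling the exponents by intervals\<close>

text \<open>
  It is convenient to look at $y = n - x$, which also runs through $1, \dots, n-1$. Since
  $n = (6k+4)k + 2k+2$, the blocks $b_i - U$ with $i = 2a$ are mapped by $x \mapsto n - x$ to the
  same family of blocks, in reverse order: $y$ lies in one of them iff
  $y = (6k+4)a + 1 + d$ with $0 \le a \le k$ and $0 \le d \le 2k$. Between two of these
  blocks there is a gap of length $4k+3$, numbered by $a < k$. The gap consists of three pieces:
  a run of $2(k-a)$ values $b_i - c_j$ with $i - j = 2a+1$; the block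
  $c_{2a+1} - U$ of length $2k+1$; and a run of $2a+2$ values $n + b_i - c_j$ with
  $j - i = 2(k-1-a)+1$.
\<close>

lemma rotation_exponents_cover:
  fixes k n x :: int and b c :: "int \<Rightarrow> int"
  assumes n_eq: "n = 6 * k^2 + 6 * k + 2"
    and b: "\<And>i. b i = k + 1 + (3 * k + 2) * i"
    and c: "\<And>i. c i = 2 * k + 1 + (3 * k + 1) * i"
    and k: "0 \<le> k" and x: "0 < x" "x < n"
  obtains (BA) i u where "i \<in> {0..2*k}" "u \<in> {-k..k}" "even i" "[x = b i - u] (mod n)"
    | (AC) i u where "i \<in> {0..2*k}" "u \<in> {-k..k}" "odd i" "[x = u - c i] (mod n)"
    | (CB) i j where "i \<in> {0..2*k}" "j \<in> {0..2*k}" "odd (i + j)" "[x = c j - b i] (mod n)"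
proof -
  define a where "a = (n - x - 1) div (6 * k + 4)"
  define d where "d = (n - x - 1) mod (6 * k + 4)"
  \<comment> \<open>position \<open>d\<close>, counted from 0, in the period \<open>a\<close>; a period is a block followed by its gap\<close>
  have ad: "n - x = (6 * k + 4) * a + d + 1" and d: "0 \<le> d" "d \<le> 6 * k + 3"
    using k pos_mod_bound[of "6 * k + 4" "n - x - 1"]
    by (auto simp: a_def d_def simp del: pos_mod_bound)
  have a: "0 \<le> a"
    using x k by (simp add: a_def pos_imp_zdiv_nonneg_iff)
  have n: "n = (6 * k + 4) * k + 2 * k + 2"
    by (simp add: n_eq power2_eq_square algebra_simps)
  have a_less: "a < k" if "2 * k < d"
  proof (rule ccontr)
    assume "\<not> a < k"
    then have "(6 * k + 4) * k \<le> (6 * k + 4) * a"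
      using k by (intro mult_left_mono) auto
    then show False using ad n x that by linarith
  qed
  have a_le: "a \<le> k"
  proof (rule ccontr)
    assume "\<not> a \<le> k"
    then have "(6 * k + 4) * (k + 1) \<le> (6 * k + 4) * a"
      using k by (intro mult_left_mono) auto
    then have "(6 * k + 4) * k + (6 * k + 4) \<le> (6 * k + 4) * a"
      by (simp add: algebra_simps)
    then show False using ad n x d k by linarith
  qed
  consider "d \<le> 2 * k" | "2 * k < d" "d \<le> 4 * k - 2 * a"
    | "4 * k - 2 * a < d" "d \<le> 6 * k + 1 - 2 * a" "2 * k < d"
    | "6 * k + 1 - 2 * a < d" "2 * k < d"
    by linarith
  then show thesis
  proof cases
    case 1
    have "x = b (2 * (k - a)) - (d - k)"
      using ad n by (simp add: b algebra_simps)
    then show thesis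
      using 1 d a a_le by (intro BA[of "2 * (k - a)" "d - k"]) auto
  next
    case 2
    \<comment> \<open>the indices of a run are read off from the distance to its first value\<close>
    define j where "j = d - 2 * k - 1"
    have "x = c j - b (j + 2 * a + 1) + n"
      using ad by (simp add: b c j_def algebra_simps)
    then show thesis
      using 2 d a by (intro CB[of "j + 2 * a + 1" j]) (auto simp: j_def cong_def)
  next
    case 3
    have "x = (5 * k + 1 - 2 * a - d) - c (2 * a + 1) + n"
      using ad by (simp add: c algebra_simps)
    then show thesis
      using 3 a a_less
      by (intro AC[of "2 * a + 1" "5 * k + 1 - 2 * a - d"]) (auto simp: cong_def)
  next
    case 4
    define i where "i = d + 2 * a - 6 * k - 2"
    have "x = c (i + 2 * (k - 1 - a) + 1) - b i"
      using ad n by (simp add: b c i_def algebra_simps)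
    then show thesis
      using 4 d a a_less
      by (intro CB[of i "i + 2 * (k - 1 - a) + 1"]) (auto simp: i_def)
  qed
qed

text \<open>
  The blocks $U + c_{2t}$ start at $k+1 + (6k+2)t$, so the exponents are taken from the period
  that starts at $k+1$ and are cut into pieces of length $6k+2$. The piece numbered $t$ consists of
  the block $U + c_{2t}$; the run of $2t+1$ values $c_j + b_i$ with $i + j = 2t$; the block
  $b_{2t+1} + U$; and the run of $2(k-t)-1$ values $c_j + b_i - n$ with $i + j = 2(t+k+1)$. The last
  piece, $t = k$, has length $4k+2$ and ends with its first run.
\<close>

lemma reflection_exponents_cover:
  fixes k n x :: int and b c :: "int \<Rightarrow> int"
  assumes n_eq: "n = 6 * k^2 + 6 * k + 2"
    and b: "\<And>i. b i = k + 1 + (3 * k + 2) * i"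
    and c: "\<And>i. c i = 2 * k + 1 + (3 * k + 1) * i"
    and k: "0 \<le> k" and x: "k + 1 \<le> x" "x < k + 1 + n"
  obtains (BA) i u where "i \<in> {0..2*k}" "u \<in> {-k..k}" "odd i" "[x = b i + u] (mod n)"
    | (AC) i u where "i \<in> {0..2*k}" "u \<in> {-k..k}" "even i" "[x = u + c i] (mod n)"
    | (CB) i j where "i \<in> {0..2*k}" "j \<in> {0..2*k}" "even (i + j)" "[x = c j + b i] (mod n)"
proof -
  define t where "t = (x - (k + 1)) div (6 * k + 2)"
  define d where "d = (x - (k + 1)) mod (6 * k + 2)"
  have td: "x = k + 1 + (6 * k + 2) * t + d" and d: "0 \<le> d" "d \<le> 6 * k + 1"
    using k pos_mod_bound[of "6 * k + 2" "x - (k + 1)"]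
    by (auto simp: t_def d_def simp del: pos_mod_bound)
  have t: "0 \<le> t"
    using x k by (simp add: t_def pos_imp_zdiv_nonneg_iff)
  have n: "n = (6 * k + 2) * k + 4 * k + 2"
    by (simp add: n_eq power2_eq_square algebra_simps)
  have t_less: "t < k" if "4 * k + 1 < d"
  proof (rule ccontr)
    assume "\<not> t < k"
    then have "(6 * k + 2) * k \<le> (6 * k + 2) * t"
      using k by (intro mult_left_mono) auto
    then show False using td n x that by linarith
  qed
  have t_le: "t \<le> k"
  proof (rule ccontr)
    assume "\<not> t \<le> k"
    then have "(6 * k + 2) * (k + 1) \<le> (6 * k + 2) * t"
      using k by (intro mult_left_mono) auto
    then have "(6 * k + 2) * k + (6 * k + 2) \<le> (6 * k + 2) * t"
      by (simp add: algebra_simps)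
    then show False using td n x d k t_less by linarith
  qed
  consider "d \<le> 2 * k" | "2 * k < d" "d \<le> 2 * k + 1 + 2 * t"
    | "2 * k + 1 + 2 * t < d" "d \<le> 4 * k + 2 + 2 * t"
    | "4 * k + 2 + 2 * t < d"
    by linarith
  then show thesis
  proof cases
    case 1
    have "x = (d - k) + c (2 * t)"
      using td by (simp add: c algebra_simps)
    then show thesis
      using 1 d t t_le by (intro AC[of "2 * t" "d - k"]) auto
  next
    case 2
    define i where "i = d - 2 * k - 1"
    have "x = c (2 * t - i) + b i"
      using td by (simp add: b c i_def algebra_simps)
    then show thesis
      using 2 t t_le by (intro CB[of i "2 * t - i"]) (auto simp: i_def)
  next
    case 3
    have "t < k"
      using 3 t_le t_less by linarith
    moreover have "x = b (2 * t + 1) + (d - 3 * k - 2 - 2 * t)"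
      using td by (simp add: b algebra_simps)
    ultimately show thesis
      using 3 t by (intro BA[of "2 * t + 1" "d - 3 * k - 2 - 2 * t"]) auto
  next
    case 4
    \<comment> \<open>here \<open>i\<close> starts at \<open>2 * t + 2\<close>, the least index for which \<open>j \<le> 2 * k\<close>\<close>
    define i where "i = d - 4 * k - 1"
    have "x = c (2 * (t + k + 1) - i) + b i - n"
      using td n by (simp add: b c i_def algebra_simps)
    then show thesis
      using 4 d t
      by (intro CB[of i "2 * (t + k + 1) - i"]) (auto simp: i_def cong_def mod_simps)
  qed
qed

section \<open>The dihedral family\<close>

theorem theorem4p8:
  fixes G :: "('a, 'b) monoid_scheme" and r s :: 'a and n k :: nat
  assumes "dihedral_group G n r s"
    and "2 * n = 3 * (2 * k + 1)^2 + 1"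
  shows "is_CEDF G (3 * (2 * k + 1)^2 + 1) 3 (2 * k + 1) 1
    [\<Union>i\<in>{0..2 * k}. {r [^]\<^bsub>G\<^esub> (- int k + int i)},
     \<Union>i\<in>{0..2 * k}. {r [^]\<^bsub>G\<^esub> (k + 1 + (3 * k + 2) * i) \<otimes>\<^bsub>G\<^esub> s [^]\<^bsub>G\<^esub> i},
     \<Union>i\<in>{0..2 * k}. {r [^]\<^bsub>G\<^esub> (2 * k + 1 + (3 * k + 1) * i) \<otimes>\<^bsub>G\<^esub> s [^]\<^bsub>G\<^esub> (i + 1)}]"
    (is "is_CEDF G _ 3 _ 1 [?A, ?B, ?C]")
proof -
  interpret dihedral_group G n r s by fact
  define b where "b i = int k + 1 + (3 * int k + 2) * i" for i
  define c where "c i = 2 * int k + 1 + (3 * int k + 1) * i" for i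
  have A: "?A = (\<lambda>i. word (int i - int k) 0) ` {0..2 * k}"
    by (auto simp: word_def r_closed)
  have "r [^]\<^bsub>G\<^esub> (k + 1 + (3 * k + 2) * i) \<otimes>\<^bsub>G\<^esub> s [^]\<^bsub>G\<^esub> i = word (b (int i)) i" for i
    unfolding word_def b_def int_pow_int[of G r, symmetric]
    by (simp add: algebra_simps)
  then have B: "?B = (\<lambda>i. word (b (int i)) i) ` {0..2 * k}"
    by auto
  have "r [^]\<^bsub>G\<^esub> (2 * k + 1 + (3 * k + 1) * i) \<otimes>\<^bsub>G\<^esub> s [^]\<^bsub>G\<^esub> (i + 1) = word (c (int i)) (i + 1)" for i
    unfolding word_def c_def int_pow_int[of G r, symmetric]
    by (simp add: algebra_simps)
  then have C: "?C = (\<lambda>i. word (c (int i)) (i + 1)) ` {0..2 * k}"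
    by auto
  have n: "int n = 6 * int k ^ 2 + 6 * int k + 2"
  proof -
    have "2 * int n = 3 * (2 * int k + 1)^2 + 1"
      using arg_cong[OF assms(2), of int] by simp
    then show ?thesis by (simp add: power2_eq_square algebra_simps)
  qed
  have in_A: "word u 0 \<in> ?A" if "u \<in> {- int k..int k}" for u
    unfolding A using that by (auto intro!: image_eqI[of _ _ "nat (u + int k)"])
  have in_B: "word (b i) (nat i) \<in> ?B" if "i \<in> {0..2 * int k}" for i
    unfolding B using that by (auto intro!: image_eqI[of _ _ "nat i"])
  have in_C: "word (c i) (nat i + 1) \<in> ?C" if "i \<in> {0..2 * int k}" for i
    unfolding C using that by (auto intro!: image_eqI[of _ _ "nat i"])
  let ?M = "diff_mset G ?B ?A + diff_mset G ?C ?B + diff_mset G ?A ?C"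
  have mem: "g \<in># ?M" if g: "g \<in> carrier G" "g \<noteq> \<one>\<^bsub>G\<^esub>" for g
  proof -
    obtain x0 e where x0: "g = word x0 e"
      using exists_word[OF g(1)] by blast
    show ?thesis
    proof (cases "even e")
      case True
      define x where "x = x0 mod int n"
      have gx: "g = word x 0"
        unfolding x0 x_def using True by (intro word_cong) (auto simp: cong_def)
      have "0 \<le> x" "x < int n"
        using n_pos by (simp_all add: x_def)
      moreover have "x \<noteq> 0"
        using gx g(2) word_0_0 by metis
      ultimately have x: "0 < x" "x < int n"
        by simp_all
      show ?thesis
        unfolding gx
      proof (rule rotation_exponents_cover[OF n b_def c_def _ x])
        fix i u assume "i \<in> {0..2 * int k}" "u \<in> {- int k..int k}" "even i" "[x = b i - u] (mod int n)"
        then have "word x 0 \<in># diff_mset G ?B ?A"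
          by (intro word_in_diff_mset[OF in_B[of i] in_A[of u]]) (auto simp: even_nat_iff)
        then show "word x 0 \<in># ?M"
          by simp
      next
        fix i u assume "i \<in> {0..2 * int k}" "u \<in> {- int k..int k}" "odd i" "[x = u - c i] (mod int n)"
        then have "word x 0 \<in># diff_mset G ?A ?C"
          by (intro word_in_diff_mset[OF in_A[of u] in_C[of i]]) (auto simp: even_nat_iff)
        then show "word x 0 \<in># ?M"
          by simp
      next
        fix i j assume "i \<in> {0..2 * int k}" "j \<in> {0..2 * int k}" "odd (i + j)" "[x = c j - b i] (mod int n)"
        then have "word x 0 \<in># diff_mset G ?C ?B"
          by (intro word_in_diff_mset[OF in_C[of j] in_B[of i]]) (auto simp: even_nat_iff)
        then show "word x 0 \<in># ?M"
          by simp
      qed simp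
    next
      case False
      define x where "x = int k + 1 + (x0 - (int k + 1)) mod int n"
      have gx: "g = word x 1"
        unfolding x0 x_def using False by (intro word_cong) (auto simp: cong_def mod_simps)
      have x: "int k + 1 \<le> x" "x < int k + 1 + int n"
        using n_pos by (simp_all add: x_def)
      show ?thesis
        unfolding gx
      proof (rule reflection_exponents_cover[OF n b_def c_def _ x])
        fix i u assume "i \<in> {0..2 * int k}" "u \<in> {- int k..int k}" "odd i" "[x = b i + u] (mod int n)"
        then have "word x 1 \<in># diff_mset G ?B ?A"
          by (intro word_in_diff_mset[OF in_B[of i] in_A[of u]]) (auto simp: even_nat_iff)
        then show "word x 1 \<in># ?M"
          by simp
      next
        fix i u assume "i \<in> {0..2 * int k}" "u \<in> {- int k..int k}" "even i" "[x = u + c i] (mod int n)"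
        then have "word x 1 \<in># diff_mset G ?A ?C"
          by (intro word_in_diff_mset[OF in_A[of u] in_C[of i]]) (auto simp: even_nat_iff)
        then show "word x 1 \<in># ?M"
          by simp
      next
        fix i j assume "i \<in> {0..2 * int k}" "j \<in> {0..2 * int k}" "even (i + j)" "[x = c j + b i] (mod int n)"
        then have "word x 1 \<in># diff_mset G ?C ?B"
          by (intro word_in_diff_mset[OF in_C[of j] in_B[of i]]) (auto simp: even_nat_iff)
        then show "word x 1 \<in># ?M"
          by simp
      qed simp
    qed
  qed
  show ?thesis
  proof (rule is_CEDF_if_differences_cover)
    show "order G = 3 * (2 * k + 1)^2 + 1"
      using order_eq assms(2) by simp
    show "card ?A \<le> 2 * k + 1" "card ?B \<le> 2 * k + 1" "card ?C \<le> 2 * k + 1"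
      unfolding A B C by (rule order.trans[OF card_image_le]; simp)+
    show "?A \<subseteq> carrier G" "?B \<subseteq> carrier G" "?C \<subseteq> carrier G"
      using r_closed s_closed by auto
  qed (fact is_group finite_carrier mem)+
qed

end
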